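(* Let $n\ge1$ and let $\lambda_{\min}(\cdot,\cdot):\mathbb{S}^n_{\succeq0}\times\mathbb{S}^n_{\succeq0}\to(-\infty,\infty]$ be defined by $$\lambda_{\min}(X,Y):=\begin{cases}\displaystyle\inf_{v\in\mathbb{R}^n,\ v\notin\mathrm{Ker}\,Y}\frac{v^\top Xv}{v^\top Yv} & (Y\neq0),\\ \infty & (Y=0).\end{cases}$$ Then for all $X,Y\in\mathbb{S}^n_{\succeq0}$, $$\lambda_{\min}(X,Y)=\sup\{\alpha\ge0\mid X-\alpha Y\succeq0\},$$ where the supremum is defined to be $0$ if there is no $\alpha\ge0$ with $X-\alpha Y\succeq0$. Consequently, $\lambda_{\min}(\cdot,\cdot)$ is nonnegative, upper semi-continuous, and quasiconcave on $\mathbb{S}^n_{\succeq0}\times\mathbb{S}^n_{\succeq0}$.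
   Context: $\mathbb{S}^n_{\succeq0}$ is the set of real symmetric positive semidefinite $n\times n$ matrices; $A\succeq0$ means that $A$ is symmetric positive semidefinite; $\mathrm{Ker}\,Y=\{v\in\mathbb{R}^n\mid Yv=0\}$. A function $f$ on a nonempty convex set $D$ is quasiconcave if its superlevel set $\{x\in D\mid f(x)\ge\alpha\}$ is convex for every $\alpha\in\mathbb{R}$. *)

theory Defs
  imports "HOL-Analysis.Analysis"
begin

definition psd :: "real^'n^'n \<Rightarrow> bool" where
  "psd A \<longleftrightarrow> transpose A = A \<and> (\<forall>v. 0 \<le> v \<bullet> (A *v v))"

definition psd_matrices :: "(real^'n^'n) set" where
  "psd_matrices = {A. psd A}"

definition mat_ker :: "real^'n^'n \<Rightarrow> (real^'n) set" where
  "mat_ker A = {v. A *v v = 0}"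

(* For psd Y and v outside its kernel the denominator below is positive, so the convention
   x / 0 = 0 plays no role on the intended domain psd_matrices \<times> psd_matrices. *)
definition lambda_min :: "real^'n^'n \<Rightarrow> real^'n^'n \<Rightarrow> ereal" where
  "lambda_min X Y =
     (if Y = 0 then \<infinity>
      else (INF v\<in>{v. v \<notin> mat_ker Y}. ereal ((v \<bullet> (X *v v)) / (v \<bullet> (Y *v v)))))"

(* The supremum of the empty set is -\<infinity> in ereal, hence the explicit value 0. *)
definition psd_step_sup :: "real^'n^'n \<Rightarrow> real^'n^'n \<Rightarrow> ereal" where
  "psd_step_sup X Y =
     (if \<exists>\<alpha>\<ge>0. psd (X - \<alpha> *\<^sub>R Y)
      then (SUP \<alpha>\<in>{\<alpha>. 0 \<le> \<alpha> \<and> psd (X - \<alpha> *\<^sub>R Y)}. ereal \<alpha>)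
      else 0)"

(* Limsup over the punctured relative filter; at isolated points of D it is -\<infinity>. *)
definition upper_semicontinuous_on :: "'a::topological_space set \<Rightarrow> ('a \<Rightarrow> ereal) \<Rightarrow> bool" where
  "upper_semicontinuous_on D f \<longleftrightarrow> (\<forall>x\<in>D. Limsup (at x within D) f \<le> f x)"

definition quasiconcave_on :: "'a::real_vector set \<Rightarrow> ('a \<Rightarrow> ereal) \<Rightarrow> bool" where
  "quasiconcave_on D f \<longleftrightarrow>
     D \<noteq> {} \<and> convex D \<and> (\<forall>\<alpha>::real. convex {x\<in>D. ereal \<alpha> \<le> f x})"

end

theory Submission
  imports Defs
begin

text \<open>For positive semidefinite \<open>X\<close>, \<open>Y\<close> and real \<open>\<alpha> \<ge> 0\<close>, the bound \<open>\<alpha> \<le> lambda_min X Y\<close> holds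
  exactly when \<open>X - \<alpha> Y\<close> is positive semidefinite: off the kernel of \<open>Y\<close> the quadratic form of \<open>Y\<close>
  is positive, so one may clear denominators, and on the kernel the condition only involves \<open>X\<close>.
  Hence the superlevel sets are preimages of the closed convex cone of positive semidefinite
  matrices under the linear maps \<open>(X, Y) \<mapsto> X - \<alpha> Y\<close>.\<close>

text \<open>The form is quadratic in \<open>v\<close> but linear in the matrix. Together with
  linearity of \<open>transpose\<close>, this cuts \<open>psd_matrices\<close> out by linear
  equations and weak linear inequalities in \<open>A\<close>, the source of both its convexity and
  its closedness.\<close>

lemma linear_quadratic_form: "linear (\<lambda>A::real^'n^'n. v \<bullet> (A *v v))"
  by (rule linearI)
    (simp_all add: matrix_vector_mult_add_rdistrib inner_add_right
      flip: scaleR_matrix_vector_assoc)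

lemma linear_transpose: "linear (transpose :: real^'n^'n \<Rightarrow> real^'n^'n)"
  by (rule linearI) (simp_all add: transpose_def vec_eq_iff)

lemma psd_0: "psd (0 :: real^'n^'n)"
  by (simp add: psd_def transpose_def vec_eq_iff)

lemma psd_add:
  assumes "psd A" "psd B"
  shows "psd (A + B)"
  using assms unfolding psd_def
  by (simp add: linear_add[OF linear_transpose] linear_add[OF linear_quadratic_form])

lemma psd_scaleR:
  assumes "psd A" "0 \<le> c"
  shows "psd (c *\<^sub>R A)"
  using assms unfolding psd_def
  by (simp add: linear_scale[OF linear_transpose] linear_scale[OF linear_quadratic_form])

lemma convex_psd_matrices: "convex (psd_matrices :: (real^'n^'n) set)"
  unfolding convex_def psd_matrices_def by (auto intro: psd_add psd_scaleR)

lemma closed_psd_matrices: "closed (psd_matrices :: (real^'n^'n) set)"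
proof -
  have eq: "(psd_matrices :: (real^'n^'n) set) =
      {A. transpose A = A} \<inter> (\<Inter>v. {A. 0 \<le> v \<bullet> (A *v v)})"
    by (auto simp: psd_matrices_def psd_def)
  show ?thesis unfolding eq
    by (intro closed_Int closed_INT ballI closed_Collect_eq closed_Collect_le continuous_intros
        linear_continuous_on linear_transpose[unfolded linear_conv_bounded_linear]
        linear_quadratic_form[unfolded linear_conv_bounded_linear])
qed

text \<open>If the form vanished at \<open>v\<close> with \<open>Y *v v\<close> nonzero, a short
  step from \<open>v\<close> in the direction opposite to \<open>Y *v v\<close> would make it
  negative: the first-order term is strictly negative and dominates the quadratic one.\<close>

lemma psd_quadratic_form_pos:
  assumes "psd Y" "Y *v v \<noteq> 0"
  shows "0 < v \<bullet> (Y *v v)"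
proof (rule ccontr)
  assume "\<not> 0 < v \<bullet> (Y *v v)"
  with assms(1) have v0: "v \<bullet> (Y *v v) = 0"
    unfolding psd_def by (metis less_eq_real_def)
  define w where "w = Y *v v"
  define b where "b = w \<bullet> (Y *v w)"
  have b: "0 \<le> b" using assms(1) by (simp add: psd_def b_def)
  have w: "0 < w \<bullet> w" using assms(2) by (simp add: w_def)
  have sym: "v \<bullet> (Y *v w) = w \<bullet> w"
    using assms(1) unfolding psd_def w_def by (metis dot_lmul_matrix vector_transpose_matrix)
  have nonneg: "0 \<le> t * (t * b - 2 * (w \<bullet> w))" for t
  proof -
    have "0 \<le> (v - t *\<^sub>R w) \<bullet> (Y *v (v - t *\<^sub>R w))"
      using assms(1) by (simp add: psd_def)
    also have "\<dots> = t * (t * b - 2 * (w \<bullet> w))"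
      using v0 sym
      by (simp add: matrix_vector_mult_diff_distrib matrix_vector_mult_scaleR inner_diff_left
          inner_diff_right b_def w_def[symmetric] algebra_simps)
    finally show ?thesis .
  qed
  \<comment> \<open>With this \<open>t\<close> one gets \<open>t * b = w \<bullet> w - t\<close>, so
    the second factor in \<open>nonneg\<close> equals \<open>- t - w \<bullet> w\<close>, which is
    negative. The \<open>+ 1\<close> keeps the denominator positive even when
    \<open>b = 0\<close>.\<close>
  define t where "t = (w \<bullet> w) / (b + 1)"
  have "0 < t" using b w by (simp add: t_def)
  moreover have "t * (b + 1) = w \<bullet> w" using b by (simp add: t_def)
  then have "t * b + t = w \<bullet> w" by (simp add: algebra_simps)
  ultimately show False using w nonneg[of t] unfolding zero_le_mult_iff by linarith
qed

lemma le_lambda_min_iff: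
  assumes X: "psd X" and Y: "psd Y" and "0 \<le> \<alpha>"
  shows "ereal \<alpha> \<le> lambda_min X Y \<longleftrightarrow> psd (X - \<alpha> *\<^sub>R Y)"
proof -
  have form: "v \<bullet> ((X - \<alpha> *\<^sub>R Y) *v v) = v \<bullet> (X *v v) - \<alpha> * (v \<bullet> (Y *v v))" for v
    by (simp add: linear_diff[OF linear_quadratic_form] linear_scale[OF linear_quadratic_form])
  have sym: "transpose (X - \<alpha> *\<^sub>R Y) = X - \<alpha> *\<^sub>R Y"
    using X Y by (simp add: psd_def linear_diff[OF linear_transpose] linear_scale[OF linear_transpose])
  have psd_iff: "psd (X - \<alpha> *\<^sub>R Y) \<longleftrightarrow> (\<forall>v. \<alpha> * (v \<bullet> (Y *v v)) \<le> v \<bullet> (X *v v))"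
    by (simp add: psd_def sym form)
  have quot: "\<alpha> \<le> v \<bullet> (X *v v) / (v \<bullet> (Y *v v)) \<longleftrightarrow> \<alpha> * (v \<bullet> (Y *v v)) \<le> v \<bullet> (X *v v)"
    if "Y *v v \<noteq> 0" for v
    using psd_quadratic_form_pos[OF Y that] by (simp add: pos_le_divide_eq)
  show ?thesis
  proof (cases "Y = 0")
    case True
    with X show ?thesis by (simp add: lambda_min_def)
  next
    case False
    then have "ereal \<alpha> \<le> lambda_min X Y \<longleftrightarrow>
        (\<forall>v. Y *v v \<noteq> 0 \<longrightarrow> \<alpha> * (v \<bullet> (Y *v v)) \<le> v \<bullet> (X *v v))"
      by (auto simp: lambda_min_def le_INF_iff mat_ker_def quot)
    \<comment> \<open>For \<open>v\<close> in the kernel of \<open>Y\<close> the inequality reads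
      \<open>0 \<le> v \<bullet> (X *v v)\<close>, which \<open>psd X\<close> supplies.\<close>
    also have "\<dots> \<longleftrightarrow> psd (X - \<alpha> *\<^sub>R Y)"
      using X unfolding psd_iff by (metis inner_zero_right mult_zero_right psd_def)
    finally show ?thesis .
  qed
qed

lemma lambda_min_nonneg:
  assumes "psd X" "psd Y"
  shows "0 \<le> lambda_min X Y"
  using le_lambda_min_iff[OF assms, of 0] assms(1) by (simp add: zero_ereal_def)

lemma lambda_min_eq_psd_step_sup:
  assumes "psd X" "psd Y"
  shows "lambda_min X Y = psd_step_sup X Y"
proof -
  let ?S = "{\<alpha>. 0 \<le> \<alpha> \<and> psd (X - \<alpha> *\<^sub>R Y)}"
  \<comment> \<open>The value \<alpha> = 0 is admissible because \<open>X\<close> itself is psd;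
    this selects the supremum branch of \<open>psd_step_sup\<close>.\<close>
  have S0: "0 \<in> ?S" using assms by simp
  then have sup: "psd_step_sup X Y = (SUP \<alpha>\<in>?S. ereal \<alpha>)"
    unfolding psd_step_sup_def by auto
  show ?thesis unfolding sup
  proof (rule antisym)
    show "(SUP \<alpha>\<in>?S. ereal \<alpha>) \<le> lambda_min X Y"
      by (rule SUP_least) (simp add: le_lambda_min_iff[OF assms])
    show "lambda_min X Y \<le> (SUP \<alpha>\<in>?S. ereal \<alpha>)"
    proof (rule ccontr)
      assume "\<not> ?thesis"
      \<comment> \<open>A real number strictly inside the gap exists even if
        \<open>lambda_min X Y\<close> is infinite. It is positive and lies below
        \<open>lambda_min X Y\<close>, so it belongs to \<open>?S\<close> and cannot exceed the
        supremum.\<close>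
      then obtain w where w: "(SUP \<alpha>\<in>?S. ereal \<alpha>) < ereal w" "ereal w < lambda_min X Y"
        by (meson ereal_dense2 not_le)
      have "ereal 0 \<le> (SUP \<alpha>\<in>?S. ereal \<alpha>)" using S0 by (rule SUP_upper)
      then have "ereal 0 < ereal w" using w(1) by (rule le_less_trans)
      then have "w \<in> ?S" using less_imp_le[OF w(2)] le_lambda_min_iff[OF assms, of w] by simp
      then have "ereal w \<le> (SUP \<alpha>\<in>?S. ereal \<alpha>)" by (rule SUP_upper)
      with w(1) show False by simp
    qed
  qed
qed

text \<open>Joint linearity in the pair, for fixed \<alpha>, serves twice: by continuity, preimages
  of closed sets are closed, and preimages of convex sets are convex.\<close>

lemma linear_matrix_pencil: "linear (\<lambda>(X, Y). X - \<alpha> *\<^sub>R Y :: real^'n^'n)"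
  by (rule linearI) (auto simp: algebra_simps)

lemma upper_semicontinuous_on_lambda_min:
  "upper_semicontinuous_on ((psd_matrices :: (real^'n^'n) set) \<times> psd_matrices)
     (\<lambda>(X, Y). lambda_min X Y)"
  unfolding upper_semicontinuous_on_def
proof
  fix p :: "(real^'n^'n) \<times> (real^'n^'n)"
  let ?D = "(psd_matrices :: (real^'n^'n) set) \<times> psd_matrices"
  let ?f = "\<lambda>(X, Y). lambda_min X Y :: ereal"
  assume p: "p \<in> ?D"
  show "Limsup (at p within ?D) ?f \<le> ?f p"
    unfolding Limsup_le_iff
  proof (intro allI impI)
    fix y assume "?f p < y"
    \<comment> \<open>The bound \<open>y\<close> may be infinite, whereas the superlevel
      characterisation needs a real, nonnegative level; \<open>w\<close> is one, since it exceeds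
      the nonnegative value at \<open>p\<close>.\<close>
    then obtain w where w: "?f p < ereal w" "ereal w < y" by (meson ereal_dense2)
    have "0 \<le> ?f p" using p by (auto simp: psd_matrices_def lambda_min_nonneg)
    then have "0 < ereal w" using w(1) by (rule le_less_trans)
    then have w0: "0 \<le> w" by simp
    let ?C = "(\<lambda>(X, Y). X - w *\<^sub>R Y) -` (psd_matrices :: (real^'n^'n) set)"
    have iff: "ereal w \<le> ?f q \<longleftrightarrow> q \<in> ?C" if "q \<in> ?D" for q
      using that w0 by (auto simp: psd_matrices_def le_lambda_min_iff)
    have "closed ?C"
      by (intro closed_vimage closed_psd_matrices linear_continuous_on
          linear_matrix_pencil[unfolded linear_conv_bounded_linear])
    moreover have "p \<notin> ?C" using iff[OF p] w(1) by (meson not_le)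
    \<comment> \<open>The complement of \<open>?C\<close> is an open neighbourhood of
      \<open>p\<close>; at its points inside \<open>?D\<close> the function stays below
      \<open>w\<close>.\<close>
    ultimately have "eventually (\<lambda>q. q \<in> - ?C) (at p within ?D)"
      by (intro eventually_at_in_open' topological_tendstoD[OF tendsto_ident_at]) auto
    moreover have "eventually (\<lambda>q. q \<in> ?D) (at p within ?D)"
      by (simp add: eventually_at_filter)
    ultimately show "eventually (\<lambda>q. ?f q < y) (at p within ?D)"
    proof eventually_elim
      case (elim q)
      then have "?f q < ereal w" using iff[of q] by (meson ComplD not_le)
      also note w(2)
      finally show ?case .
    qed
  qed
qed

lemma quasiconcave_on_lambda_min:
  "quasiconcave_on ((psd_matrices :: (real^'n^'n) set) \<times> psd_matrices)
     (\<lambda>(X, Y). lambda_min X Y)"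
proof -
  let ?D = "(psd_matrices :: (real^'n^'n) set) \<times> psd_matrices"
  let ?f = "\<lambda>(X, Y). lambda_min X Y :: ereal"
  have ne: "?D \<noteq> {}" using psd_0 by (metis Times_empty emptyE mem_Collect_eq psd_matrices_def)
  have D: "convex ?D" by (intro convex_Times convex_psd_matrices)
  have "convex {p\<in>?D. ereal \<alpha> \<le> ?f p}" for \<alpha>
  proof (cases "0 \<le> \<alpha>")
    case True
    then have "{p\<in>?D. ereal \<alpha> \<le> ?f p} = ?D \<inter> (\<lambda>(X, Y). X - \<alpha> *\<^sub>R Y) -` psd_matrices"
      by (auto simp: psd_matrices_def le_lambda_min_iff)
    then show ?thesis
      by (simp only:) (intro convex_Int D convex_linear_vimage linear_matrix_pencil convex_psd_matrices)
  next
    \<comment> \<open>Below level 0 the characterisation does not apply, but nonnegativity makes the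
      superlevel set all of \<open>?D\<close>.\<close>
    case False
    then have "ereal \<alpha> \<le> 0" by simp
    moreover have "0 \<le> ?f p" if "p \<in> ?D" for p
      using that by (auto simp: psd_matrices_def lambda_min_nonneg)
    ultimately have "{p\<in>?D. ereal \<alpha> \<le> ?f p} = ?D" using order_trans by blast
    then show ?thesis using D by (simp only:)
  qed
  with ne D show ?thesis unfolding quasiconcave_on_def by blast
qed

theorem theorem16:
  shows "(\<forall>X\<in>psd_matrices :: (real^'n^'n) set. \<forall>Y\<in>psd_matrices. lambda_min X Y = psd_step_sup X Y)
    \<and> (\<forall>X\<in>psd_matrices :: (real^'n^'n) set. \<forall>Y\<in>psd_matrices. 0 \<le> lambda_min X Y)
    \<and> upper_semicontinuous_on ((psd_matrices :: (real^'n^'n) set) \<times> psd_matrices)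
        (\<lambda>(X, Y). lambda_min X Y)
    \<and> quasiconcave_on ((psd_matrices :: (real^'n^'n) set) \<times> psd_matrices)
        (\<lambda>(X, Y). lambda_min X Y)"
  using upper_semicontinuous_on_lambda_min quasiconcave_on_lambda_min
  by (auto simp: psd_matrices_def lambda_min_nonneg intro: lambda_min_eq_psd_step_sup)

end
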